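(* Let $\psi(p)=(\phi_1(a,b),\phi_2(a,b))$, $p=(a,b)$, be a bicomplex function that is holomorphic in a domain $G\subseteq\mathrm{B}$. Then $\psi$ possesses derivatives of all orders in $G$, and each of these derivatives is holomorphic in $G$.
   Context: $\mathrm{B}=\mathbb{C}^2$ is the space of bicomplex numbers $p=(a,b)$, $a,b\in\mathbb{C}$, with componentwise addition and the commutative multiplication $(a,b)\odot(c,d)=(ac-bd,\ bc+ad)$. The norm is $\|(a,b)\|=\sqrt{|a|^2+|b|^2}$. A bicomplex number $(a,b)$ is singular if $a^2+b^2=0$, and nonsingular otherwise; a nonsingular $(a,b)$ has the inverse $\left(\frac{a}{a^2+b^2},\frac{-b}{a^2+b^2}\right)$, and $r/q=r\odot q^{-1}$ for nonsingular $q$. A domain is a connected open set. A bicomplex function $\psi$ is holomorphic at $p$ if it is defined in a neighbourhood of $p$ and the derivative $$\psi'(p)=\lim_{\Delta p\to 0,\ \Delta p\ \text{nonsingular}}\frac{\psi(p+\Delta p)-\psi(p)}{\Delta p}$$ exists (the limit being taken over nonsingular $\Delta p$ only); it is holomorphic in $G$ if it is holomorphic at every point of $G$. Higher derivatives are defined by iteration: $\psi^{(0)}=\psi$, $\psi^{(n+1)}=(\psi^{(n)})'$. *)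

theory Defs
  imports "HOL-Complex_Analysis.Complex_Analysis"
begin

text \<open>
  Bicomplex numbers are pairs of complex numbers. The addition, the topology and the norm
  \<open>norm (a, b) = sqrt ((norm a)\<^sup>2 + (norm b)\<^sup>2)\<close> are those of the library's product type.
\<close>

type_synonym bicomplex = "complex \<times> complex"

definition bc_mult :: "bicomplex \<Rightarrow> bicomplex \<Rightarrow> bicomplex"  (infixl \<open>\<odot>\<close> 70) where
  "p \<odot> q = (fst p * fst q - snd p * snd q, snd p * fst q + fst p * snd q)"

definition bc_singular :: "bicomplex \<Rightarrow> bool" where
  "bc_singular p \<longleftrightarrow> (fst p)\<^sup>2 + (snd p)\<^sup>2 = 0"

text \<open>Only meaningful at nonsingular arguments; the value at a singular one is \<open>0\<close>.\<close>

definition bc_inverse :: "bicomplex \<Rightarrow> bicomplex" where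
  "bc_inverse p =
     (fst p / ((fst p)\<^sup>2 + (snd p)\<^sup>2), - snd p / ((fst p)\<^sup>2 + (snd p)\<^sup>2))"

definition bc_divide :: "bicomplex \<Rightarrow> bicomplex \<Rightarrow> bicomplex" where
  "bc_divide r q = r \<odot> bc_inverse q"

text \<open>
  The increment tends to \<open>0\<close> through nonsingular values only. Functions are total, but the
  limit depends only on the values of \<open>\<psi>\<close> in an arbitrarily small neighbourhood of \<open>p\<close>, so
  for an open set \<open>G\<close> the values outside \<open>G\<close> are irrelevant at the points of \<open>G\<close>.
\<close>

definition has_bc_deriv :: "(bicomplex \<Rightarrow> bicomplex) \<Rightarrow> bicomplex \<Rightarrow> bicomplex \<Rightarrow> bool" where
  "has_bc_deriv \<psi> D p \<longleftrightarrow>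
     ((\<lambda>h. bc_divide (\<psi> (p + h) - \<psi> p) h) \<longlongrightarrow> D) (at 0 within {h. \<not> bc_singular h})"

definition bc_holomorphic_at :: "(bicomplex \<Rightarrow> bicomplex) \<Rightarrow> bicomplex \<Rightarrow> bool" where
  "bc_holomorphic_at \<psi> p \<longleftrightarrow> (\<exists>D. has_bc_deriv \<psi> D p)"

text \<open>Meant for open sets \<open>G\<close>.\<close>

definition bc_holomorphic_on :: "(bicomplex \<Rightarrow> bicomplex) \<Rightarrow> bicomplex set \<Rightarrow> bool" where
  "bc_holomorphic_on \<psi> G \<longleftrightarrow> (\<forall>p\<in>G. bc_holomorphic_at \<psi> p)"

text \<open>Unspecified at points where the limit does not exist.\<close>

definition bc_deriv :: "(bicomplex \<Rightarrow> bicomplex) \<Rightarrow> bicomplex \<Rightarrow> bicomplex" where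
  "bc_deriv \<psi> p = (THE D. has_bc_deriv \<psi> D p)"

fun bc_higher_deriv :: "nat \<Rightarrow> (bicomplex \<Rightarrow> bicomplex) \<Rightarrow> bicomplex \<Rightarrow> bicomplex" where
  "bc_higher_deriv 0 \<psi> = \<psi>"
| "bc_higher_deriv (Suc n) \<psi> = bc_deriv (bc_higher_deriv n \<psi>)"

lemma bc_mult_inverse:
  assumes "\<not> bc_singular p"
  shows "p \<odot> bc_inverse p = (1, 0)"
proof -
  obtain a b where p: "p = (a, b)" by (cases p)
  have nz: "a\<^sup>2 + b\<^sup>2 \<noteq> 0" using assms by (simp add: bc_singular_def p)
  have "a * a / (a\<^sup>2 + b\<^sup>2) + b * b / (a\<^sup>2 + b\<^sup>2) = 1"
    using nz by (simp add: add_divide_distrib [symmetric] power2_eq_square)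
  then show ?thesis by (simp add: p bc_mult_def bc_inverse_def)
qed

lemma bc_nonsingular_filter_nontrivial: "at 0 within {h. \<not> bc_singular h} \<noteq> bot"
proof -
  have "\<exists>x\<in>{h. \<not> bc_singular h}. x \<noteq> 0 \<and> dist x 0 < e" if "e > 0" for e :: real
    using that
    by (intro bexI [where x = "(of_real (e / 2), 0)"])
       (auto simp: bc_singular_def zero_prod_def dist_Pair_Pair)
  then have "(0 :: bicomplex) islimpt {h. \<not> bc_singular h}"
    by (simp add: islimpt_approachable)
  then show ?thesis by (simp add: trivial_limit_within)
qed

lemma has_bc_deriv_unique:
  assumes "has_bc_deriv \<psi> D p" "has_bc_deriv \<psi> E p"
  shows "D = E"
  using assms bc_nonsingular_filter_nontrivial tendsto_unique
  unfolding has_bc_deriv_def by blast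

lemma has_bc_deriv_imp_bc_deriv:
  assumes "has_bc_deriv \<psi> D p"
  shows "bc_deriv \<psi> p = D"
  unfolding bc_deriv_def using assms has_bc_deriv_unique by blast

end

theory Submission
  imports Defs
begin

text \<open>
  In the coordinates \<open>(a + \<i> b, a - \<i> b)\<close> the product \<open>\<odot>\<close> becomes componentwise, and the singular
  numbers are those with a vanishing coordinate. For one component \<open>f\<close> of the transformed
  function, differentiability at \<open>(u, v)\<close> bounds the increment of \<open>f\<close> by a multiple of the increment
  of \<open>u\<close> alone; since only nonsingular increments are allowed, comparing the limits at \<open>(u, v)\<close>
  and at a nearby \<open>(u, v + k)\<close> shows \<open>f (u, v + k) = f (u, v)\<close>. So locally the function is a pair of
  ordinary holomorphic functions, one in each coordinate, and these have holomorphic derivatives.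
\<close>

section \<open>Increments in two independent complex coordinates\<close>

definition nonzero_coords :: "(complex \<times> complex) set" where
  "nonzero_coords = {h. fst h \<noteq> 0 \<and> snd h \<noteq> 0}"

text \<open>This models one component of the bicomplex difference quotient after the change of
  coordinates: the increment moves both variables, but only its first entry is divided by.\<close>

definition has_fst_deriv :: "(complex \<times> complex \<Rightarrow> complex) \<Rightarrow> complex \<Rightarrow> complex \<times> complex \<Rightarrow> bool" where
  "has_fst_deriv f D p \<longleftrightarrow> ((\<lambda>h. (f (p + h) - f p) / fst h) \<longlongrightarrow> D) (at 0 within nonzero_coords)"

text \<open>The diagonal is a one-variable path through admissible increments. It shows that the
  filter is nontrivial and later reduces limits to ordinary complex derivatives.\<close>

lemma filterlim_diagonal_nonzero_coords:
  "filterlim (\<lambda>x. (x, x)) (at 0 within nonzero_coords) (at 0)"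
proof -
  have "((\<lambda>x::complex. (x, x)) \<longlongrightarrow> (0, 0)) (at 0)"
    by (intro tendsto_Pair tendsto_ident_at)
  moreover have "eventually (\<lambda>x::complex. x \<noteq> 0) (at 0)"
    by (simp add: eventually_at_filter)
  ultimately show ?thesis
    by (auto simp: filterlim_at nonzero_coords_def zero_prod_def elim: eventually_mono)
qed

lemma nonzero_coords_filter_nontrivial: "at 0 within nonzero_coords \<noteq> bot"
proof
  assume "at 0 within nonzero_coords = bot"
  then have "filtermap (\<lambda>x::complex. (x, x)) (at 0) = bot"
    using filterlim_diagonal_nonzero_coords by (simp add: filterlim_def bot_unique)
  then show False by (simp add: filtermap_bot_iff)
qed

text \<open>A convergent quotient times a denominator tending to 0 tends to 0. The resulting
  continuity is along admissible increments only.\<close>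

lemma has_fst_deriv_imp_tendsto:
  assumes "has_fst_deriv f D p"
  shows "((\<lambda>h. f (p + h)) \<longlongrightarrow> f p) (at 0 within nonzero_coords)"
proof -
  have "((\<lambda>h::complex\<times>complex. fst h) \<longlongrightarrow> fst (0::complex\<times>complex)) (at 0 within nonzero_coords)"
    by (intro tendsto_intros)
  then have "((\<lambda>h. (f (p + h) - f p) / fst h * fst h + f p) \<longlongrightarrow> D * 0 + f p) (at 0 within nonzero_coords)"
    using assms unfolding has_fst_deriv_def by (intro tendsto_intros) auto
  moreover have "eventually (\<lambda>h. (f (p + h) - f p) / fst h * fst h + f p = f (p + h))
      (at 0 within nonzero_coords)"
    by (auto simp: eventually_at_filter nonzero_coords_def)
  ultimately show ?thesis by (simp add: tendsto_cong)
qed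

text \<open>Two limits are compared as \<open>(u, w)\<close> is approached: the derivative at
  \<open>(u, w)\<close> serves only for continuity there, while the bound around
  \<open>(u, v)\<close> depends on the first entry of the increment, which vanishes in the
  limit.\<close>

lemma has_fst_deriv_imp_locally_const_snd:
  assumes deriv: "has_fst_deriv f D (u, v)"
    and ev: "eventually (\<lambda>w. \<exists>D. has_fst_deriv f D (u, w)) (at v)"
  shows "eventually (\<lambda>w. f (u, v) = f (u, w)) (at v)"
proof -
  \<comment> \<open>Any constant strictly above \<open>norm D\<close> eventually bounds the
    quotients; \<open>norm D + 1\<close> is one such choice.\<close>
  have "eventually (\<lambda>h. norm ((f ((u, v) + h) - f (u, v)) / fst h) < norm D + 1)
      (at 0 within nonzero_coords)"
    using deriv unfolding has_fst_deriv_def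
    by (intro order_tendstoD(2) [OF tendsto_norm]) auto
  then obtain d where d: "d > 0"
    and "\<forall>h\<in>nonzero_coords. h \<noteq> 0 \<and> dist h 0 < d \<longrightarrow>
      norm ((f ((u, v) + h) - f (u, v)) / fst h) < norm D + 1"
    unfolding eventually_at by blast
  moreover have "h \<noteq> 0" if "h \<in> nonzero_coords" for h
    using that by (auto simp: nonzero_coords_def)
  ultimately have bound: "norm ((f ((u, v) + h) - f (u, v)) / fst h) < norm D + 1"
    if "h \<in> nonzero_coords" "norm h < d" for h
    using that by (metis dist_0_norm dist_commute)
  have const: "f (u, v) = f (u, w)"
    if w: "w \<noteq> v" "dist w v < d" and E: "has_fst_deriv f E (u, w)" for w E
  proof -
    define k where "k = w - v"
    have k: "k \<noteq> 0" "norm k < d" using w by (auto simp: k_def dist_norm)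
    \<comment> \<open>Staying below \<open>norm k\<close> keeps \<open>k + snd h\<close> nonzero, so
      \<open>(0, k) + h\<close> is admissible; staying below \<open>d - norm k\<close> keeps it
      within the radius where \<open>bound\<close> holds.\<close>
    have "eventually (\<lambda>h. norm h < min (norm k) (d - norm k)) (at (0::complex\<times>complex) within nonzero_coords)"
      using k by (intro order_tendstoD(2) [OF tendsto_norm_zero]) (auto simp: tendsto_ident_at)
    moreover have "eventually (\<lambda>h. h \<in> nonzero_coords) (at 0 within nonzero_coords)"
      by (simp add: eventually_at_filter)
    ultimately have "eventually (\<lambda>h. norm (f ((u, w) + h) - f (u, v)) \<le> (norm D + 1) * norm (fst h))
        (at 0 within nonzero_coords)"
    proof eventually_elim
      case (elim h)
      have "norm (snd h) \<le> norm h" using norm_snd_le [of "snd h" "fst h"] by simp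
      with elim have "k + snd h \<noteq> 0"
        by (metis add_eq_0_iff min_less_iff_conj norm_minus_cancel not_le add.commute)
      then have "(0, k) + h \<in> nonzero_coords" using elim by (auto simp: nonzero_coords_def)
      moreover have "norm ((0, k) + h) < d"
        using norm_triangle_ineq [of "(0, k)" h] elim by (simp add: norm_Pair)
      ultimately have "norm ((f ((u, v) + ((0, k) + h)) - f (u, v)) / fst ((0, k) + h)) < norm D + 1"
        by (rule bound)
      moreover have "(u, v) + ((0, k) + h) = (u, w) + h"
        by (simp add: k_def prod_eq_iff)
      moreover have "fst h \<noteq> 0" using elim by (simp add: nonzero_coords_def)
      ultimately show ?case
        by (simp add: norm_divide divide_simps split: if_splits)
    qed
    moreover have "((\<lambda>h::complex\<times>complex. (norm D + 1) * norm (fst h)) \<longlongrightarrow> 0)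
        (at 0 within nonzero_coords)"
      using tendsto_fst [OF tendsto_ident_at, of "0::complex\<times>complex"]
      by (intro tendsto_mult_right_zero tendsto_norm_zero) simp
    ultimately have "((\<lambda>h. f ((u, w) + h) - f (u, v)) \<longlongrightarrow> 0) (at 0 within nonzero_coords)"
      by (rule Lim_null_comparison)
    then have "((\<lambda>h. f ((u, w) + h)) \<longlongrightarrow> f (u, v)) (at 0 within nonzero_coords)"
      by (rule LIM_zero_cancel)
    \<comment> \<open>The same values tend to \<open>f (u, w)\<close> by continuity along admissible
      increments, so the two limits agree.\<close>
    then show ?thesis
      by (rule tendsto_unique [OF nonzero_coords_filter_nontrivial _ has_fst_deriv_imp_tendsto [OF E]])
  qed
  have "eventually (\<lambda>w. w \<noteq> v \<and> dist w v < d) (at v)"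
    using d by (auto simp: eventually_at)
  with ev show ?thesis
    by eventually_elim (auto intro: const)
qed

text \<open>Connectedness of \<open>B\<close> upgrades local constancy in the second variable to
  constancy.\<close>

lemma has_fst_deriv_const_snd:
  assumes "open B" "connected B" "u \<in> A"
    and deriv: "\<And>u v. u \<in> A \<Longrightarrow> v \<in> B \<Longrightarrow> \<exists>D. has_fst_deriv f D (u, v)"
    and "v \<in> B" "w \<in> B"
  shows "f (u, v) = f (u, w)"
proof (rule connected_local_const [of B v w "\<lambda>v. f (u, v)"])
  show "\<forall>v\<in>B. eventually (\<lambda>w. f (u, v) = f (u, w)) (at v within B)"
  proof
    fix v assume v: "v \<in> B"
    then obtain D where D: "has_fst_deriv f D (u, v)" using deriv assms(3) by blast
    have "eventually (\<lambda>w. w \<in> B) (at v)"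
      using \<open>open B\<close> v by (simp add: eventually_at_in_open')
    then have "eventually (\<lambda>w. \<exists>D. has_fst_deriv f D (u, w)) (at v)"
      by eventually_elim (rule deriv [OF assms(3)])
    then show "eventually (\<lambda>w. f (u, v) = f (u, w)) (at v within B)"
      unfolding at_within_open [OF v \<open>open B\<close>] by (rule has_fst_deriv_imp_locally_const_snd [OF D])
  qed
qed (use assms in auto)

text \<open>Independence of the second variable turns the quotient along a diagonal increment into
  the ordinary difference quotient in \<open>u\<close>.\<close>

lemma has_fst_deriv_holomorphic_on:
  assumes "open A" "open B" "connected B" "v \<in> B"
    and deriv: "\<And>u v. u \<in> A \<Longrightarrow> v \<in> B \<Longrightarrow> \<exists>D. has_fst_deriv f D (u, v)"
  shows "(\<lambda>u. f (u, v)) holomorphic_on A"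
  unfolding holomorphic_on_open [OF \<open>open A\<close>]
proof
  fix u assume u: "u \<in> A"
  then obtain D where D: "has_fst_deriv f D (u, v)" using deriv assms(4) by blast
  \<comment> \<open>The increment \<open>(x, 0)\<close> is not admissible, hence the detour through
    \<open>(x, x)\<close>.\<close>
  have "((\<lambda>x. (f ((u, v) + (x, x)) - f (u, v)) / fst (x, x)) \<longlongrightarrow> D) (at 0)"
    using filterlim_compose [OF D [unfolded has_fst_deriv_def] filterlim_diagonal_nonzero_coords] .
  moreover have "eventually (\<lambda>x. (f ((u, v) + (x, x)) - f (u, v)) / fst (x, x) =
      (f (u + x, v) - f (u, v)) / x) (at 0)"
  proof -
    have "((\<lambda>x. u + x) \<longlongrightarrow> u) (at 0)" "((\<lambda>x. v + x) \<longlongrightarrow> v) (at 0)"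
      by (auto intro!: tendsto_eq_intros)
    then have "eventually (\<lambda>x. u + x \<in> A) (at 0)" "eventually (\<lambda>x. v + x \<in> B) (at 0)"
      using topological_tendstoD assms u by blast+
    then show ?thesis
    proof eventually_elim
      case (elim x)
      then have "f (u + x, v + x) = f (u + x, v)"
        using has_fst_deriv_const_snd [OF assms(2,3) _ deriv] assms(4) by blast
      then show ?case by simp
    qed
  qed
  ultimately have "((\<lambda>x. (f (u + x, v) - f (u, v)) / x) \<longlongrightarrow> D) (at 0)"
    by (rule Lim_transform_eventually)
  then show "\<exists>D. ((\<lambda>u. f (u, v)) has_field_derivative D) (at u)"
    by (auto simp: DERIV_def)
qed

section \<open>The idempotent coordinates\<close>

text \<open>\<open>bc_coord1\<close> and \<open>bc_coord2\<close> are the two complex algebra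
  homomorphisms to the complex numbers: they send \<open>(0, 1)\<close>, whose square is
  \<open>(-1, 0)\<close>, to \<i> and to its negative.\<close>

definition bc_coord1 :: "bicomplex \<Rightarrow> complex" where
  "bc_coord1 p = fst p + \<i> * snd p"

definition bc_coord2 :: "bicomplex \<Rightarrow> complex" where
  "bc_coord2 p = fst p - \<i> * snd p"

definition bc_of_coords :: "complex \<times> complex \<Rightarrow> bicomplex" where
  "bc_of_coords q = ((fst q + snd q) / 2, (fst q - snd q) / (2 * \<i>))"

lemma bc_coord_of_coords [simp]:
  "bc_coord1 (bc_of_coords q) = fst q" "bc_coord2 (bc_of_coords q) = snd q"
  by (simp_all add: bc_coord1_def bc_coord2_def bc_of_coords_def field_simps)

lemma bc_of_coords_coord [simp]: "bc_of_coords (bc_coord1 p, bc_coord2 p) = p"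
  by (simp add: bc_coord1_def bc_coord2_def bc_of_coords_def prod_eq_iff)

lemma bc_coord_diff:
  "bc_coord1 (p - q) = bc_coord1 p - bc_coord1 q" "bc_coord2 (p - q) = bc_coord2 p - bc_coord2 q"
  by (simp_all add: bc_coord1_def bc_coord2_def algebra_simps)

lemma bc_of_coords_add: "bc_of_coords (p + q) = bc_of_coords p + bc_of_coords q"
  by (simp add: bc_of_coords_def field_simps)

lemma bc_of_coords_0 [simp]: "bc_of_coords 0 = 0" "bc_of_coords (0, 0) = 0"
  by (simp_all add: bc_of_coords_def zero_prod_def)

lemma bc_coord_0 [simp]: "bc_coord1 0 = 0" "bc_coord2 0 = 0"
  by (simp_all add: bc_coord1_def bc_coord2_def)

lemma bc_singular_iff_coord: "bc_singular p \<longleftrightarrow> bc_coord1 p = 0 \<or> bc_coord2 p = 0"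
proof -
  have "(fst p)\<^sup>2 + (snd p)\<^sup>2 = bc_coord1 p * bc_coord2 p"
    by (simp add: bc_coord1_def bc_coord2_def algebra_simps power2_eq_square)
  then show ?thesis by (simp add: bc_singular_def)
qed

lemma bc_singular_0: "bc_singular 0"
  by (simp add: bc_singular_iff_coord)

lemma bc_coord_mult:
  "bc_coord1 (p \<odot> q) = bc_coord1 p * bc_coord1 q" "bc_coord2 (p \<odot> q) = bc_coord2 p * bc_coord2 q"
  by (simp_all add: bc_coord1_def bc_coord2_def bc_mult_def algebra_simps)

text \<open>Both coordinates of \<open>(1, 0)\<close> are 1, so multiplicativity sends
  \<open>bc_inverse h\<close> to the reciprocals of the coordinates of \<open>h\<close>.\<close>

lemma bc_coord_divide:
  assumes "\<not> bc_singular h"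
  shows "bc_coord1 (bc_divide r h) = bc_coord1 r / bc_coord1 h"
    and "bc_coord2 (bc_divide r h) = bc_coord2 r / bc_coord2 h"
proof -
  have "bc_coord1 h * bc_coord1 (bc_inverse h) = 1" "bc_coord2 h * bc_coord2 (bc_inverse h) = 1"
    using bc_mult_inverse [OF assms]
    by (simp_all add: bc_coord_mult [symmetric]) (simp_all add: bc_coord1_def bc_coord2_def)
  then have "bc_coord1 (bc_inverse h) = 1 / bc_coord1 h" "bc_coord2 (bc_inverse h) = 1 / bc_coord2 h"
    using assms by (simp_all add: bc_singular_iff_coord field_simps)
  then show "bc_coord1 (bc_divide r h) = bc_coord1 r / bc_coord1 h"
    and "bc_coord2 (bc_divide r h) = bc_coord2 r / bc_coord2 h"
    by (simp_all add: bc_divide_def bc_coord_mult)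
qed

lemma tendsto_bc_coord:
  assumes "(f \<longlongrightarrow> l) F"
  shows "((\<lambda>x. bc_coord1 (f x)) \<longlongrightarrow> bc_coord1 l) F" "((\<lambda>x. bc_coord2 (f x)) \<longlongrightarrow> bc_coord2 l) F"
  unfolding bc_coord1_def bc_coord2_def by (intro tendsto_intros assms)+

lemma tendsto_bc_of_coords:
  assumes "(f \<longlongrightarrow> l) F"
  shows "((\<lambda>x. bc_of_coords (f x)) \<longlongrightarrow> bc_of_coords l) F"
  unfolding bc_of_coords_def by (intro tendsto_intros assms) auto

section \<open>Transfer of derivatives between bicomplex numbers and coordinates\<close>

text \<open>The bicomplex limit is composed with \<open>bc_of_coords\<close>, which maps admissible
  increments to nonsingular ones, and then projected to a coordinate. The swap lets
  \<open>has_fst_deriv\<close> also cover division by the second coordinate.\<close>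

lemma has_bc_deriv_imp_has_fst_deriv:
  assumes "has_bc_deriv \<psi> D (bc_of_coords (u, v))"
  shows "has_fst_deriv (\<lambda>q. bc_coord1 (\<psi> (bc_of_coords q))) (bc_coord1 D) (u, v)"
    and "has_fst_deriv (\<lambda>q. bc_coord2 (\<psi> (bc_of_coords (prod.swap q)))) (bc_coord2 D) (v, u)"
proof -
  let ?Q = "\<lambda>h. bc_divide (\<psi> (bc_of_coords (u, v) + h) - \<psi> (bc_of_coords (u, v))) h"
  have nonsing: "\<not> bc_singular (bc_of_coords h)" "\<not> bc_singular (bc_of_coords (prod.swap h))"
    if "h \<in> nonzero_coords" for h
    using that by (auto simp: bc_singular_iff_coord nonzero_coords_def)
  have ev: "eventually (\<lambda>h. h \<in> nonzero_coords) (at 0 within nonzero_coords)"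
    by (simp add: eventually_at_filter)
  have ev1: "eventually (\<lambda>h. bc_of_coords h \<in> {h. \<not> bc_singular h} \<and> bc_of_coords h \<noteq> 0)
      (at 0 within nonzero_coords)"
    and ev2: "eventually (\<lambda>h. bc_of_coords (prod.swap h) \<in> {h. \<not> bc_singular h} \<and>
      bc_of_coords (prod.swap h) \<noteq> 0) (at 0 within nonzero_coords)"
    by (rule eventually_mono [OF ev], use nonsing bc_singular_0 in force)+
  have "((\<lambda>h::complex\<times>complex. bc_of_coords h) \<longlongrightarrow> bc_of_coords 0) (at 0 within nonzero_coords)"
    by (intro tendsto_bc_of_coords tendsto_ident_at)
  then have 1: "filterlim bc_of_coords (at 0 within {h. \<not> bc_singular h}) (at 0 within nonzero_coords)"
    using ev1 unfolding filterlim_at bc_of_coords_0 by blast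
  have "((\<lambda>h::complex\<times>complex. bc_of_coords (snd h, fst h)) \<longlongrightarrow>
      bc_of_coords (snd (0::complex\<times>complex), fst (0::complex\<times>complex))) (at 0 within nonzero_coords)"
    by (intro tendsto_bc_of_coords tendsto_intros)
  then have 2: "filterlim (\<lambda>h. bc_of_coords (prod.swap h)) (at 0 within {h. \<not> bc_singular h})
      (at 0 within nonzero_coords)"
    using ev2 unfolding filterlim_at bc_of_coords_0 fst_zero snd_zero prod.swap_def by blast
  have lim: "(?Q \<longlongrightarrow> D) (at 0 within {h. \<not> bc_singular h})"
    using assms by (simp add: has_bc_deriv_def)
  show "has_fst_deriv (\<lambda>q. bc_coord1 (\<psi> (bc_of_coords q))) (bc_coord1 D) (u, v)"
    unfolding has_fst_deriv_def
    by (rule Lim_transform_eventually [OF tendsto_bc_coord(1) [OF filterlim_compose [OF lim 1]]],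
        rule eventually_mono [OF ev])
       (simp add: bc_coord_divide nonsing bc_coord_diff bc_of_coords_add)
  show "has_fst_deriv (\<lambda>q. bc_coord2 (\<psi> (bc_of_coords (prod.swap q)))) (bc_coord2 D) (v, u)"
    unfolding has_fst_deriv_def
    by (rule Lim_transform_eventually [OF tendsto_bc_coord(2) [OF filterlim_compose [OF lim 2]]],
        rule eventually_mono [OF ev])
       (simp add: bc_coord_divide nonsing(2) [unfolded prod.swap_def] bc_coord_diff
         bc_of_coords_add [symmetric] prod.swap_def)
qed

text \<open>This is the way back. A nonsingular \<open>h\<close> has two nonzero coordinates, each a
  legitimate increment for one of the one-variable derivatives.\<close>

lemma has_bc_deriv_of_coords:
  assumes "open A" "open B" "u \<in> A" "v \<in> B"
    and F: "(F has_field_derivative F') (at u)" and H: "(H has_field_derivative H') (at v)"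
    and eq: "\<And>u v. u \<in> A \<Longrightarrow> v \<in> B \<Longrightarrow> \<psi> (bc_of_coords (u, v)) = bc_of_coords (F u, H v)"
  shows "has_bc_deriv \<psi> (bc_of_coords (F', H')) (bc_of_coords (u, v))"
proof -
  let ?N = "at 0 within {h. \<not> bc_singular h}"
  have nonsing: "eventually (\<lambda>h. \<not> bc_singular h) ?N"
    by (simp add: eventually_at_filter)
  have t1: "(bc_coord1 \<longlongrightarrow> 0) ?N" and t2: "(bc_coord2 \<longlongrightarrow> 0) ?N"
    using tendsto_bc_coord [OF tendsto_ident_at [of "0::bicomplex"]]
    by simp_all
  have f1: "filterlim bc_coord1 (at 0) ?N" and f2: "filterlim bc_coord2 (at 0) ?N"
    by (rule filterlim_atI [OF t1], rule eventually_mono [OF nonsing], simp add: bc_singular_iff_coord)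
       (rule filterlim_atI [OF t2], rule eventually_mono [OF nonsing], simp add: bc_singular_iff_coord)
  have "((\<lambda>h. bc_of_coords ((F (u + bc_coord1 h) - F u) / bc_coord1 h,
      (H (v + bc_coord2 h) - H v) / bc_coord2 h)) \<longlongrightarrow> bc_of_coords (F', H')) ?N"
    using filterlim_compose [OF F [unfolded DERIV_def] f1] filterlim_compose [OF H [unfolded DERIV_def] f2]
    by (intro tendsto_bc_of_coords tendsto_Pair)
  moreover have "eventually (\<lambda>h. bc_of_coords ((F (u + bc_coord1 h) - F u) / bc_coord1 h,
      (H (v + bc_coord2 h) - H v) / bc_coord2 h) =
      bc_divide (\<psi> (bc_of_coords (u, v) + h) - \<psi> (bc_of_coords (u, v))) h) ?N"
  proof -
    \<comment> \<open>For small \<open>h\<close> the shifted point stays in the product of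
      \<open>A\<close> and \<open>B\<close>, where \<open>eq\<close> applies.\<close>
    have "((\<lambda>h. u + bc_coord1 h) \<longlongrightarrow> u) ?N" "((\<lambda>h. v + bc_coord2 h) \<longlongrightarrow> v) ?N"
      using t1 t2 by (auto intro!: tendsto_eq_intros)
    then have "eventually (\<lambda>h. u + bc_coord1 h \<in> A) ?N" "eventually (\<lambda>h. v + bc_coord2 h \<in> B) ?N"
      using topological_tendstoD assms(1-4) by blast+
    with nonsing show ?thesis
    proof eventually_elim
      case (elim h)
      let ?d = "bc_divide (\<psi> (bc_of_coords (u, v) + h) - \<psi> (bc_of_coords (u, v))) h"
      have "bc_of_coords (u, v) + h = bc_of_coords (u + bc_coord1 h, v + bc_coord2 h)"
        using bc_of_coords_add [of "(u, v)" "(bc_coord1 h, bc_coord2 h)"] by simp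
      with elim have "bc_coord1 ?d = (F (u + bc_coord1 h) - F u) / bc_coord1 h"
        "bc_coord2 ?d = (H (v + bc_coord2 h) - H v) / bc_coord2 h"
        using assms(3,4) by (simp_all add: bc_coord_divide bc_coord_diff eq)
      then show ?case using bc_of_coords_coord [of ?d] by simp
    qed
  qed
  ultimately show ?thesis
    unfolding has_bc_deriv_def by (rule Lim_transform_eventually)
qed

section \<open>Local splitting and higher derivatives\<close>

lemma bc_holomorphic_on_imp_local_coords:
  assumes "open G" "bc_holomorphic_on \<psi> G" "bc_of_coords (u, v) \<in> G"
  obtains A B F H where "open A" "open B" "u \<in> A" "v \<in> B" "F holomorphic_on A" "H holomorphic_on B"
    "\<And>u v. u \<in> A \<Longrightarrow> v \<in> B \<Longrightarrow> \<psi> (bc_of_coords (u, v)) = bc_of_coords (F u, H v)"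
proof -
  have "continuous_on UNIV bc_of_coords"
    unfolding bc_of_coords_def by (intro continuous_intros) auto
  then have "open (bc_of_coords -` G)"
    using \<open>open G\<close> by (simp add: continuous_on_open_vimage)
  then obtain A0 B0 where AB0: "open A0" "open B0" "(u, v) \<in> A0 \<times> B0" "A0 \<times> B0 \<subseteq> bc_of_coords -` G"
    using assms(3) by (metis open_prod_elim vimage_eq)
  \<comment> \<open>Shrinking to discs provides the connected factors that constancy in the other
    variable requires.\<close>
  then obtain r s where rs: "r > 0" "ball u r \<subseteq> A0" "s > 0" "ball v s \<subseteq> B0"
    by (metis mem_Sigma_iff open_contains_ball)
  define A B where "A = ball u r" and "B = ball v s"
  have AB: "open A" "open B" "connected A" "connected B" "u \<in> A" "v \<in> B"
    using rs by (auto simp: A_def B_def)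
  have sub: "bc_of_coords (z, w) \<in> G" if "z \<in> A" "w \<in> B" for z w
    using that rs AB0(4) unfolding A_def B_def by blast
  let ?f = "\<lambda>q. bc_coord1 (\<psi> (bc_of_coords q))"
  let ?g = "\<lambda>q. bc_coord2 (\<psi> (bc_of_coords (prod.swap q)))"
  have f: "\<exists>D. has_fst_deriv ?f D (z, w)" and g: "\<exists>D. has_fst_deriv ?g D (w, z)"
    if "z \<in> A" "w \<in> B" for z w
    using assms(2) sub [OF that] has_bc_deriv_imp_has_fst_deriv
    unfolding bc_holomorphic_on_def bc_holomorphic_at_def by blast+
  show thesis
  \<comment> \<open>Each component ignores the other coordinate, which may therefore be frozen at
    the base point.\<close>
  proof (rule that [of A B "\<lambda>z. ?f (z, v)" "\<lambda>w. ?g (w, u)"])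
    show "(\<lambda>z. ?f (z, v)) holomorphic_on A"
      using has_fst_deriv_holomorphic_on [OF AB(1,2,4,6) f] .
    show "(\<lambda>w. ?g (w, u)) holomorphic_on B"
      using has_fst_deriv_holomorphic_on [OF AB(2,1,3,5) g] .
    fix z w assume zw: "z \<in> A" "w \<in> B"
    have "?f (z, w) = ?f (z, v)"
      using has_fst_deriv_const_snd [OF AB(2,4) zw(1) f zw(2) AB(6)] .
    moreover have "?g (w, z) = ?g (w, u)"
      using has_fst_deriv_const_snd [OF AB(1,3) zw(2) g zw(1) AB(5)] .
    ultimately show "\<psi> (bc_of_coords (z, w)) = bc_of_coords (?f (z, v), ?g (w, u))"
      using bc_of_coords_coord [of "\<psi> (bc_of_coords (z, w))"] by simp
  qed (use AB in auto)
qed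

text \<open>The derivative splits again, into \<open>deriv F\<close> and \<open>deriv H\<close>,
  which are holomorphic by the one-variable theory; so the splitting criterion applies a second
  time.\<close>

lemma bc_holomorphic_on_bc_deriv:
  assumes "open G" "bc_holomorphic_on \<psi> G"
  shows "bc_holomorphic_on (bc_deriv \<psi>) G"
  unfolding bc_holomorphic_on_def
proof
  fix p assume p: "p \<in> G"
  define u v where "u = bc_coord1 p" and "v = bc_coord2 p"
  have p_eq: "p = bc_of_coords (u, v)" by (simp add: u_def v_def)
  obtain A B F H where AB: "open A" "open B" "u \<in> A" "v \<in> B"
    and FH: "F holomorphic_on A" "H holomorphic_on B"
    and eq: "\<And>u v. u \<in> A \<Longrightarrow> v \<in> B \<Longrightarrow> \<psi> (bc_of_coords (u, v)) = bc_of_coords (F u, H v)"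
    using bc_holomorphic_on_imp_local_coords [OF assms p [unfolded p_eq]] by metis
  \<comment> \<open>The formula is proved on the whole product, not just at \<open>p\<close>,
    because differentiating once more needs it at neighbouring points.\<close>
  have "bc_deriv \<psi> (bc_of_coords (z, w)) = bc_of_coords (deriv F z, deriv H w)"
    if "z \<in> A" "w \<in> B" for z w
    using that AB FH eq
    by (intro has_bc_deriv_imp_bc_deriv has_bc_deriv_of_coords [of A B]) (auto intro: holomorphic_derivI)
  then have "has_bc_deriv (bc_deriv \<psi>) (bc_of_coords (deriv (deriv F) u, deriv (deriv H) v)) p"
    unfolding p_eq using AB FH
    by (intro has_bc_deriv_of_coords [of A B]) (auto intro: holomorphic_derivI holomorphic_deriv)
  then show "bc_holomorphic_at (bc_deriv \<psi>) p"
    unfolding bc_holomorphic_at_def by blast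
qed

theorem theorem4p2:
  fixes \<psi> :: "bicomplex \<Rightarrow> bicomplex" and G :: "bicomplex set"
  assumes "open G" and "connected G"
    and "bc_holomorphic_on \<psi> G"
  shows "\<forall>n. (\<forall>p\<in>G. has_bc_deriv (bc_higher_deriv n \<psi>) (bc_higher_deriv (Suc n) \<psi> p) p)
             \<and> bc_holomorphic_on (bc_higher_deriv n \<psi>) G"
proof -
  have hol: "bc_holomorphic_on (bc_higher_deriv n \<psi>) G" for n
    by (induction n) (use assms bc_holomorphic_on_bc_deriv in auto)
  \<comment> \<open>Holomorphy supplies some derivative at \<open>p\<close>; uniqueness of the limit
    identifies it with the value picked by \<open>bc_deriv\<close>.\<close>
  moreover have "has_bc_deriv (bc_higher_deriv n \<psi>) (bc_higher_deriv (Suc n) \<psi> p) p"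
    if "p \<in> G" for n p
    using hol [of n] that has_bc_deriv_imp_bc_deriv
    unfolding bc_holomorphic_on_def bc_holomorphic_at_def by fastforce
  ultimately show ?thesis by blast
qed

end
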